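(* Let $k\ge1$, $i\in\{1,\dots,k\}$, and let $\mathbf{n}=[n_1,\dots,n_k]$ be nonnegative integers with $n_i\ge1$; put $n=\sum_{\ell=1}^k n_\ell$ and $d=n+1-n_i$. For a specification $\mathbf{m}$, let $s_k(r;\mathbf{m})$ be the number of sequences over $\{1,\dots,k\}$ in which each integer $j$ appears exactly $m_j$ times and which contain exactly $r$ adjacent pairs $(a_t,a_{t+1})$ with $a_{t+1}-a_t=1$, and let $P_k(w,\mathbf{m})=\sum_r s_k(r;\mathbf{m})w^r$. Writing $\mathbf{n}+j\mathbf{e}^{(i)}=[n_1,\dots,n_i+j,\dots,n_k]$, we have $$\sum_{j=0}^d(-1)^j\binom{d}{j}P_k(w,\mathbf{n}+j\mathbf{e}^{(i)})=0,$$ and for every $r\ge0$, $$\sum_{j=0}^d(-1)^j\binom{d}{j}s_k(r;\mathbf{n}+j\mathbf{e}^{(i)})=0.$$ *)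

theory Defs
  imports "HOL-Computational_Algebra.Polynomial"
begin

definition spec_seqs :: "nat \<Rightarrow> (nat \<Rightarrow> nat) \<Rightarrow> nat list set" where
  "spec_seqs k m = {xs. set xs \<subseteq> {1..k} \<and> (\<forall>j\<in>{1..k}. count_list xs j = m j)}"

(* Successions a(t+1) - a(t) = 1; written additively because subtraction on nat truncates. *)
definition successions :: "nat list \<Rightarrow> nat" where
  "successions xs = card {t. Suc t < length xs \<and> xs ! Suc t = xs ! t + 1}"

definition succ_count :: "nat \<Rightarrow> nat \<Rightarrow> (nat \<Rightarrow> nat) \<Rightarrow> nat" where
  "succ_count k r m = card {xs \<in> spec_seqs k m. successions xs = r}"

(* The range of r is cut off at the length of the sequences, beyond which succ_count k r m = 0;
   see coeff_succ_poly. *)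
definition succ_poly :: "nat \<Rightarrow> (nat \<Rightarrow> nat) \<Rightarrow> int poly" where
  "succ_poly k m = (\<Sum>r\<le>(\<Sum>l=1..k. m l). monom (int (succ_count k r m)) r)"

lemma length_spec_seqs:
  assumes "xs \<in> spec_seqs k m"
  shows "length xs = (\<Sum>l=1..k. m l)"
proof -
  have "length xs = (\<Sum>l\<in>set xs. count_list xs l)"
    by (simp add: sum_count_set)
  also have "\<dots> = (\<Sum>l=1..k. count_list xs l)"
    using assms by (intro sum.mono_neutral_left) (auto simp: spec_seqs_def count_list_0_iff)
  also have "\<dots> = (\<Sum>l=1..k. m l)"
    using assms by (intro sum.cong) (auto simp: spec_seqs_def)
  finally show ?thesis .
qed

lemma finite_spec_seqs: "finite (spec_seqs k m)"
proof (rule finite_subset)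
  show "spec_seqs k m \<subseteq> {xs. set xs \<subseteq> {1..k} \<and> length xs = (\<Sum>l=1..k. m l)}"
    using length_spec_seqs by (auto simp: spec_seqs_def)
qed (rule finite_lists_length_eq, simp)

lemma successions_le_length: "successions xs \<le> length xs"
proof -
  have "successions xs \<le> card {..<length xs}"
    unfolding successions_def by (rule card_mono) auto
  then show ?thesis by simp
qed

lemma succ_count_eq_0: "succ_count k r m = 0" if "r > (\<Sum>l=1..k. m l)"
proof -
  have "successions xs \<noteq> r" if "xs \<in> spec_seqs k m" for xs
    using that \<open>r > (\<Sum>l=1..k. m l)\<close> length_spec_seqs[OF that] successions_le_length[of xs] by simp
  then have "{xs \<in> spec_seqs k m. successions xs = r} = {}" by blast
  then show ?thesis unfolding succ_count_def by (simp only: card.empty)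
qed

lemma coeff_succ_poly: "coeff (succ_poly k m) r = int (succ_count k r m)"
  by (cases "r \<le> (\<Sum>l=1..k. m l)") (auto simp: succ_poly_def coeff_sum succ_count_eq_0)

end

(* Shrinking every run of i's to a single i changes neither the other letters nor the number of
   successions, since (i, i) is not a succession. A shrunk word with s \<ge> 1 letters i arises
   from (m - 1) choose (s - 1) words with m \<ge> 1 letters i. As no two of these s letters are
   adjacent, s \<le> d, where d - 1 is the number of other letters. So for m \<ge> 1 the count is
   a polynomial in m of degree less than d, and its d-th differences vanish. *)
theory Submission
  imports Defs
begin

section \<open>Collapsing the runs of one letter\<close>

fun collapse :: "'a \<Rightarrow> 'a list \<Rightarrow> 'a list" where
  "collapse a [] = []"
| "collapse a [x] = [x]"
| "collapse a (x # y # xs) =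
    (if x = a \<and> y = a then collapse a (y # xs) else x # collapse a (y # xs))"

lemma collapse_eq_Nil_iff [simp]: "collapse a xs = [] \<longleftrightarrow> xs = []"
  by (induction a xs rule: collapse.induct) auto

lemma hd_collapse [simp]: "hd (collapse a xs) = hd xs"
  by (induction a xs rule: collapse.induct) auto

text \<open>A test on \<open>hd xs\<close> replaces the two-element pattern, so that inductions can
  follow the plain structure of the list.\<close>

lemma collapse_Cons:
  "collapse a (x # xs) = (if x = a \<and> xs \<noteq> [] \<and> hd xs = a then collapse a xs else x # collapse a xs)"
  by (cases xs) auto

lemma collapse_idem [simp]: "collapse a (collapse a xs) = collapse a xs"
  by (induction xs) (auto simp: collapse_Cons)

lemma set_collapse [simp]: "set (collapse a xs) = set xs"
  by (induction a xs rule: collapse.induct) auto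

lemma length_collapse_le: "length (collapse a xs) \<le> length xs"
  by (induction a xs rule: collapse.induct) auto

lemma count_list_collapse [simp]: "b \<noteq> a \<Longrightarrow> count_list (collapse a xs) b = count_list xs b"
  by (induction a xs rule: collapse.induct) auto

text \<open>In a collapsed word every \<open>a\<close> except a leading one directly follows a
  letter other than \<open>a\<close>, and these predecessors are distinct. The correction for a
  leading \<open>a\<close> lets the induction go through.\<close>

lemma count_list_collapse_le:
  "2 * count_list (collapse a xs) a \<le>
    length (collapse a xs) + (if xs \<noteq> [] \<and> hd xs = a then 1 else 0)"
  by (induction xs) (auto simp: collapse_Cons split: if_splits)

lemma successions_Nil [simp]: "successions [] = 0"
  and successions_singleton [simp]: "successions [x] = 0"
  by (simp_all add: successions_def)

lemma successions_Cons_Cons [simp]: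
  "successions (x # y # xs) = (if y = x + 1 then 1 else 0) + successions (y # xs)"
proof -
  let ?T = "{t. Suc t < length (y # xs) \<and> (y # xs) ! Suc t = (y # xs) ! t + 1}"
  have "{t. Suc t < length (x # y # xs) \<and> (x # y # xs) ! Suc t = (x # y # xs) ! t + 1} =
      (if y = x + 1 then {0} else {}) \<union> Suc ` ?T" (is "?L = ?R")
  proof (rule set_eqI)
    fix t show "t \<in> ?L \<longleftrightarrow> t \<in> ?R"
      by (cases t) (auto simp: image_iff)
  qed
  moreover have "finite ?T" by (rule finite_subset[of _ "{..<length (y # xs)}"]) auto
  ultimately show ?thesis
    unfolding successions_def by (simp add: card_image card_insert_if)
qed

lemma successions_collapse [simp]: "successions (collapse a xs) = successions xs"
proof (induction a xs rule: collapse.induct)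
  case (3 a x y xs)
  then show ?case
  proof (cases "x = a \<and> y = a")
    case False
    \<comment> \<open>The collapsed tail still begins with \<open>y\<close>, so the pair
      \<open>(x, y)\<close> survives.\<close>
    obtain zs where "collapse a (y # xs) = y # zs"
      by (metis collapse_eq_Nil_iff hd_collapse list.collapse list.distinct(1) list.sel(1))
    with 3 False show ?thesis by auto
  qed auto
qed auto

section \<open>Counting the words with a given collapse\<close>

definition expansions :: "'a \<Rightarrow> 'a list \<Rightarrow> nat \<Rightarrow> 'a list set" where
  "expansions a w m = {xs. collapse a xs = w \<and> count_list xs a = m}"

lemma expansions_Nil: "expansions a [] m = (if m = 0 then {[]} else {})"
  by (auto simp: expansions_def)

lemma expansions_Cons_neq:
  assumes "b \<noteq> a"
  shows "expansions a (b # w) m = Cons b ` expansions a w m"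
proof -
  have "collapse a xs = b # w \<longleftrightarrow> (\<exists>ys. xs = b # ys \<and> collapse a ys = w)" for xs
  proof (cases xs)
    case (Cons x ys)
    show ?thesis
    proof (cases "x = b")
      case False
      then have "collapse a xs \<noteq> b # w"
        using hd_collapse[of a xs] Cons by (metis list.sel(1))
      with False Cons show ?thesis by simp
    qed (use Cons assms in \<open>simp add: collapse_Cons\<close>)
  qed simp
  then show ?thesis using assms by (fastforce simp: expansions_def)
qed

lemma expansions_Cons_0: "expansions a (a # w) 0 = {}"
proof -
  have "a \<in> set xs" if "collapse a xs = a # w" for xs
    using set_collapse[of a xs] that by auto
  then show ?thesis by (auto simp: expansions_def count_list_0_iff)
qed

text \<open>After deletion of the leading \<open>a\<close>, either its run continues and the rest
  still collapses to \<open>a # w\<close>, or the run is over and the rest collapses to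
  \<open>w\<close>. The assumption makes the run end where \<open>w\<close> begins.\<close>

lemma expansions_Cons_Suc:
  assumes "w = [] \<or> hd w \<noteq> a"
  shows "expansions a (a # w) (Suc m) =
    Cons a ` (expansions a (a # w) m \<union> expansions a w m)"
proof -
  have *: "collapse a (a # ys) = a # w \<longleftrightarrow> collapse a ys = a # w \<or> collapse a ys = w" for ys
  proof (cases "ys \<noteq> [] \<and> hd ys = a")
    case True
    then have "collapse a ys \<noteq> w"
      using assms hd_collapse[of a ys] collapse_eq_Nil_iff[of a ys] by metis
    with True show ?thesis by (simp add: collapse_Cons)
  next
    case False
    then have "collapse a ys \<noteq> a # w"
      by (metis hd_collapse collapse_eq_Nil_iff list.sel(1) list.distinct(1))
    with False show ?thesis by (auto simp: collapse_Cons)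
  qed
  have collapse_iff: "collapse a xs = a # w \<longleftrightarrow>
      (\<exists>ys. xs = a # ys \<and> (collapse a ys = a # w \<or> collapse a ys = w))" for xs
  proof (cases xs)
    case (Cons x ys)
    show ?thesis
    proof (cases "x = a")
      case False
      then have "collapse a xs \<noteq> a # w"
        using hd_collapse[of a xs] Cons by (metis list.sel(1))
      with False Cons show ?thesis by simp
    qed (use Cons * in simp)
  qed simp
  have "expansions a (a # w) (Suc m) =
      Cons a ` {ys. (collapse a ys = a # w \<or> collapse a ys = w) \<and> count_list ys a = m}"
    (is "?L = ?R")
  proof (rule set_eqI)
    fix xs
    have "xs \<in> ?L \<longleftrightarrow> collapse a xs = a # w \<and> count_list xs a = Suc m"
      by (simp add: expansions_def)
    then show "xs \<in> ?L \<longleftrightarrow> xs \<in> ?R"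
      by (subst (asm) collapse_iff) auto
  qed
  also have "{ys. (collapse a ys = a # w \<or> collapse a ys = w) \<and> count_list ys a = m} =
      expansions a (a # w) m \<union> expansions a w m"
    unfolding expansions_def by blast
  finally show ?thesis .
qed

text \<open>The number of compositions of \<open>m\<close> into \<open>s\<close> positive parts: the
  first part either exceeds 1 and is lowered, or equals 1 and is removed.\<close>

fun num_expansions :: "nat \<Rightarrow> nat \<Rightarrow> nat" where
  "num_expansions 0 m = (if m = 0 then 1 else 0)"
| "num_expansions (Suc s) 0 = 0"
| "num_expansions (Suc s) (Suc m) = num_expansions (Suc s) m + num_expansions s m"

text \<open>This is Pascal's rule. Positivity of the second argument matters:
  \<open>num_expansions 1 0\<close> is 0, whereas the polynomial for one part is constantly
  1.\<close>

lemma num_expansions_Suc_Suc: "num_expansions (Suc s) (Suc m) = m choose s"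
proof (induction m arbitrary: s)
  case 0
  then show ?case by (cases s) auto
next
  case (Suc m)
  then show ?case by (cases s)
    \<comment> \<open>The recursion is unfolded only at the outer \<open>Suc (Suc m)\<close>, which
      leaves terms of the shape of the induction hypothesis.\<close>
    (auto simp del: num_expansions.simps(3) simp: num_expansions.simps(3)[of _ "Suc m"])
qed

text \<open>Each \<open>a\<close> of the collapsed word \<open>w\<close> grows into a run of
  positive length, and these lengths form a composition of \<open>m\<close>.\<close>

lemma finite_card_expansions:
  "collapse a w = w \<Longrightarrow>
    finite (expansions a w m) \<and> card (expansions a w m) = num_expansions (count_list w a) m"
proof (induction w arbitrary: m)
  case Nil
  then show ?case by (auto simp: expansions_Nil)
next
  case (Cons b w)
  \<comment> \<open>A second \<open>a\<close> at the front would be absorbed, and the collapse would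
    be shorter than the word.\<close>
  have w: "w = [] \<or> hd w \<noteq> a" if "b = a"
  proof (rule ccontr)
    assume "\<not> ?thesis"
    then have "collapse a w = b # w" using Cons.prems that by (auto simp: collapse_Cons)
    then show False using length_collapse_le[of a w] by simp
  qed
  then have "collapse a w = w"
    using Cons.prems by (auto simp: collapse_Cons split: if_splits)
  note IH = Cons.IH[OF this]
  show ?case
  proof (cases "b = a")
    case False
    then show ?thesis using IH by (auto simp: expansions_Cons_neq card_image)
  next
    case True
    show ?thesis
    \<comment> \<open>An inner induction is needed because \<open>expansions_Cons_Suc\<close> refers
      back to the same word \<open>a # w\<close> with a smaller count.\<close>
    proof (induction m)
      case 0
      then show ?case using True by (simp add: expansions_Cons_0)
    next
      case (Suc m)
      have "expansions a (a # w) m \<inter> expansions a w m = {}"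
        by (auto simp: expansions_def)
      then show ?case using True IH Suc w
        by (simp add: expansions_Cons_Suc card_image card_Un_disjoint)
    qed
  qed
qed

section \<open>Higher differences of binomial coefficients\<close>

lemma alternating_binomial_sum_Suc:
  fixes f :: "nat \<Rightarrow> 'a::comm_ring_1"
  shows "(\<Sum>j\<le>Suc d. (-1) ^ j * of_nat (Suc d choose j) * f j) =
    (\<Sum>j\<le>d. (-1) ^ j * of_nat (d choose j) * (f j - f (Suc j)))"
proof -
  \<comment> \<open>One half of Pascal's rule for \<open>Suc d choose Suc j\<close>, together with
    the term \<open>f 0\<close>, is reindexed; its top term vanishes since
    \<open>d choose Suc d\<close> is 0.\<close>
  have "(\<Sum>j\<le>d. (-1) ^ Suc j * of_nat (d choose Suc j) * f (Suc j)) + f 0 =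
      (\<Sum>j\<le>Suc d. (-1) ^ j * of_nat (d choose j) * f j)"
    by (simp only: sum.atMost_Suc_shift) simp
  also have "\<dots> = (\<Sum>j\<le>d. (-1) ^ j * of_nat (d choose j) * f j)"
    by (simp add: binomial_eq_0)
  finally show ?thesis
    by (simp only: sum.atMost_Suc_shift)
       (simp add: algebra_simps sum.distrib sum_subtractf sum_negf)
qed

text \<open>By Pascal's rule each difference lowers the index \<open>s\<close> by one, up to sign,
  until a constant is reached, whose difference is 0.\<close>

lemma alternating_binomial_sum_choose:
  "s < d \<Longrightarrow>
    (\<Sum>j\<le>d. (-1) ^ j * of_nat (d choose j) * of_nat ((m + j) choose s)) = (0 :: 'a::comm_ring_1)"
proof (induction d arbitrary: s)
  case (Suc d)
  show ?case
  proof (cases s)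
    case 0
    then show ?thesis by (subst alternating_binomial_sum_Suc) simp
  next
    case (Suc s')
    then have "(\<Sum>j\<le>d. (-1) ^ j * of_nat (d choose j) * of_nat ((m + j) choose s')) = (0 :: 'a)"
      using Suc.IH Suc.prems by simp
    then show ?thesis
      by (subst alternating_binomial_sum_Suc) (simp add: Suc sum_negf)
  qed
qed simp

section \<open>Sorting the words by their collapse\<close>

definition skeletons :: "nat \<Rightarrow> nat \<Rightarrow> nat \<Rightarrow> (nat \<Rightarrow> nat) \<Rightarrow> nat list set" where
  "skeletons k i r n =
    {w \<in> spec_seqs k (n(i := count_list w i)). collapse i w = w \<and> successions w = r}"

lemma sum_fun_upd_nat:
  fixes n :: "nat \<Rightarrow> nat"
  assumes "i \<in> {1..k}"
  shows "(\<Sum>l=1..k. (n(i := c)) l) = (\<Sum>l\<in>{1..k} - {i}. n l) + c"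
  using assms by (subst sum.remove[of _ i]) auto

text \<open>With N letters other than \<open>i\<close> and s letters \<open>i\<close>, the bound 2s
  \<le> (N + s) + 1 gives s \<le> N + 1. The first bound keeps the degree below \<open>d\<close>;
  the second gives finiteness.\<close>

lemma skeleton_bounds:
  assumes "i \<in> {1..k}" "w \<in> skeletons k i r n"
  shows "count_list w i \<le> (\<Sum>l\<in>{1..k} - {i}. n l) + 1"
    and "length w \<le> 2 * (\<Sum>l\<in>{1..k} - {i}. n l) + 1"
proof -
  have w: "collapse i w = w" "w \<in> spec_seqs k (n(i := count_list w i))"
    using assms by (auto simp: skeletons_def)
  have "2 * count_list w i \<le> length w + 1"
    using count_list_collapse_le[of i w] w by (auto split: if_splits)
  moreover have "length w = (\<Sum>l\<in>{1..k} - {i}. n l) + count_list w i"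
    using length_spec_seqs[OF w(2)] sum_fun_upd_nat[OF assms(1)] by simp
  ultimately show "count_list w i \<le> (\<Sum>l\<in>{1..k} - {i}. n l) + 1"
    and "length w \<le> 2 * (\<Sum>l\<in>{1..k} - {i}. n l) + 1"
    by simp_all
qed

lemma finite_skeletons:
  assumes "i \<in> {1..k}"
  shows "finite (skeletons k i r n)"
proof (rule finite_subset)
  show "skeletons k i r n \<subseteq>
      {w. set w \<subseteq> {1..k} \<and> length w \<le> 2 * (\<Sum>l\<in>{1..k} - {i}. n l) + 1}"
    using skeleton_bounds(2)[OF assms] by (auto simp: skeletons_def spec_seqs_def)
qed (rule finite_lists_length_le, simp)

text \<open>The sets \<open>expansions i w m\<close> are the fibres of \<open>collapse i\<close>.
  Skeletons leave the number of letters \<open>i\<close> free, so the index set does not depend on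
  \<open>m\<close> and all dependence on \<open>m\<close> sits in the summand.\<close>

lemma succ_count_eq_sum_skeletons:
  assumes "i \<in> {1..k}"
  shows "succ_count k r (n(i := m)) =
    (\<Sum>w\<in>skeletons k i r n. num_expansions (count_list w i) m)"
proof -
  have exp: "finite (expansions i w m)"
    "card (expansions i w m) = num_expansions (count_list w i) m"
    if "w \<in> skeletons k i r n" for w
    using finite_card_expansions[of i w m] that by (simp_all add: skeletons_def)
  have "xs \<in> spec_seqs k (n(i := m)) \<and> successions xs = r \<longleftrightarrow>
      collapse i xs \<in> skeletons k i r n \<and> count_list xs i = m" for xs
    using assms by (auto simp: spec_seqs_def skeletons_def split: if_splits)
  then have "{xs \<in> spec_seqs k (n(i := m)). successions xs = r} =
      (\<Union>w\<in>skeletons k i r n. expansions i w m)"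
    by (auto simp: expansions_def)
  moreover have "card (\<Union>w\<in>skeletons k i r n. expansions i w m) =
      (\<Sum>w\<in>skeletons k i r n. card (expansions i w m))"
    using finite_skeletons[OF assms] exp(1)
    by (intro card_UN_disjoint) (auto simp: expansions_def)
  moreover have "\<dots> = (\<Sum>w\<in>skeletons k i r n. num_expansions (count_list w i) m)"
    using exp(2) by (rule sum.cong[OF refl])
  ultimately show ?thesis by (simp add: succ_count_def)
qed

theorem theorem3:
  fixes k i d :: nat and n :: "nat \<Rightarrow> nat"
  assumes "k \<ge> 1" and "i \<in> {1..k}" and "n i \<ge> 1"
    and "d = (\<Sum>l=1..k. n l) + 1 - n i"
  shows "(\<Sum>j=0..d. (-1) ^ j * of_nat (d choose j) * succ_poly k (n(i := n i + j))) = 0 \<and>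
         (\<forall>r. (\<Sum>j=0..d. (-1) ^ j * int (d choose j) * int (succ_count k r (n(i := n i + j)))) = 0)"
proof -
  have d: "d = (\<Sum>l\<in>{1..k} - {i}. n l) + 1"
    using sum_fun_upd_nat[OF assms(2), of n "n i"] assms(4) by simp
  obtain p where p: "n i = Suc p"
    using assms(3) by (cases "n i") auto
  have differences_0: "(\<Sum>j=0..d. (-1) ^ j * int (d choose j) * int (num_expansions s (n i + j))) = 0"
    if "s \<le> d" for s
  \<comment> \<open>For s = 0 every term vanishes because \<open>n i + j\<close> is positive;
    otherwise the binomial index s - 1 is less than \<open>d\<close>.\<close>
  proof (cases s)
    case (Suc s')
    then show ?thesis
      using alternating_binomial_sum_choose[of s' d p, where 'a = int] that
      by (simp only: p add_Suc num_expansions_Suc_Suc atMost_atLeast0)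
  qed (simp add: p)
  have count: "(\<Sum>j=0..d. (-1) ^ j * int (d choose j) * int (succ_count k r (n(i := n i + j)))) = 0" for r
  proof -
    have "(\<Sum>j=0..d. (-1) ^ j * int (d choose j) * int (succ_count k r (n(i := n i + j)))) =
        (\<Sum>w\<in>skeletons k i r n.
          \<Sum>j=0..d. (-1) ^ j * int (d choose j) * int (num_expansions (count_list w i) (n i + j)))"
      by (subst sum.swap) (simp add: succ_count_eq_sum_skeletons[OF assms(2)] sum_distrib_left)
    also have "\<dots> = 0"
      using skeleton_bounds(1)[OF assms(2)] d by (intro sum.neutral ballI differences_0) simp
    finally show ?thesis .
  qed
  \<comment> \<open>The constant polynomial factor becomes a scalar, so that coefficients can be
    compared one by one.\<close>
  have "(-1) ^ j * of_nat c * q = smult ((-1) ^ j * int c) q" for j c and q :: "int poly"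
    by (cases "even j") (simp_all add: of_nat_poly)
  then have "(\<Sum>j=0..d. (-1) ^ j * of_nat (d choose j) * succ_poly k (n(i := n i + j))) = 0"
    using count by (intro poly_eqI) (simp add: coeff_sum coeff_succ_poly)
  with count show ?thesis by blast
qed

end
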